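(* Let $P\subset\mathbb{R}^2$ be a finite set of points. (1) If $|P|<5$ then $\nu^n(P)=\emptyset$ for some $n\in\mathbb{N}$. (2) If $|P|=5$ then either $\nu^n(P)=\emptyset$ for some $n\in\mathbb{N}$, or $|\nu^n(P)|=5$ for all $n\in\mathbb{N}$. (3) If $|\nu(P)|>|P|$ then $|P|>5$. (4) If $|\mathrm{Int}(P)|=2$ and $I_c(P)=0$, then $|\nu(P)|=|P|$.
   Context: For a finite set $P\subset\mathbb{R}^2$ (the generating set) and $p\in P$, the Voronoi polygon of $p$ is $V(p)=\{x\in\mathbb{R}^2 : \|p-x\|\le\|p'-x\| \text{ for all } p'\in P\}$, and the Voronoi tessellation is $\Upsilon(P)=\{V(p) : p\in P\}$. A point is a Voronoi vertex of $\Upsilon(P)$ if it is the (one-point) intersection of three or more Voronoi polygons of $\Upsilon(P)$. The Voronoi iteration $\nu(P)$ is the (finite) set of all Voronoi vertices of $\Upsilon(P)$ (with $\nu(\emptyset)=\emptyset$), and $\nu^n(P)=\nu(\nu^{n-1}(P))$ for $n\ge2$, $\nu^1=\nu$. $|\cdot|$ denotes cardinality. $\mathrm{Bd}(P)=P\cap\partial CH(P)$, where $CH(P)$ is the convex hull of $P$ and $\partial CH(P)$ its topological boundary in $\mathbb{R}^2$; $\mathrm{Int}(P)=P\setminus\mathrm{Bd}(P)$. An empty circle of $P$ is a circle whose interior (open disc) contains no point of $P$ and which itself passes through three or more points of $P$. If $C_1,\dots,C_k$ are all the empty circles of $P$, then $I_c(P)=\sum_{i=1}^k\left(|C_i\cap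 P|-3\right)$. *)

theory Defs
  imports "HOL-Analysis.Analysis"
begin

definition voronoi_polygon :: "(real^2) set \<Rightarrow> real^2 \<Rightarrow> (real^2) set" where
  "voronoi_polygon P p = {x. \<forall>p'\<in>P. norm (p - x) \<le> norm (p' - x)}"

definition voronoi_tessellation :: "(real^2) set \<Rightarrow> (real^2) set set" where
  "voronoi_tessellation P = {voronoi_polygon P p | p. p \<in> P}"

definition voronoi_vertex :: "(real^2) set \<Rightarrow> real^2 \<Rightarrow> bool" where
  "voronoi_vertex P x \<longleftrightarrow>
     (\<exists>F. F \<subseteq> voronoi_tessellation P \<and> card F \<ge> 3 \<and> \<Inter>F = {x})"

text \<open>The convention that the iteration maps the empty set to the empty set holds
  automatically: the tessellation of the empty set has no polygons.\<close>

definition voronoi_iteration :: "(real^2) set \<Rightarrow> (real^2) set" where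
  "voronoi_iteration P = {x. voronoi_vertex P x}"

definition Bd :: "(real^2) set \<Rightarrow> (real^2) set" where
  "Bd P = P \<inter> frontier (convex hull P)"

definition Int_pts :: "(real^2) set \<Rightarrow> (real^2) set" where
  "Int_pts P = P - Bd P"

text \<open>Circles are taken as point sets, so that each one is counted once.\<close>

definition empty_circles :: "(real^2) set \<Rightarrow> (real^2) set set" where
  "empty_circles P = {sphere c r | c r.
     r > 0 \<and> ball c r \<inter> P = {} \<and> card (sphere c r \<inter> P) \<ge> 3}"

definition I_c :: "(real^2) set \<Rightarrow> int" where
  "I_c P = (\<Sum>C\<in>empty_circles P. (int (card (C \<inter> P)) - 3))"

end

theory Submission
  imports Defs
begin

text \<open>All four claims follow from one formula: if the sites \<open>P\<close> are not collinear, then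
  \<open>|\<nu>(P)| = |P| + |Int(P)| - 2 - I_c(P)\<close> (\<open>card_voronoi_iteration\<close>), whereas collinear sites have no Voronoi
  vertex. As at least three sites lie on the boundary of the hull (\<open>card_Bd_ge_3\<close>) and \<open>I_c\<close> is nonnegative,
  \<open>|\<nu>(P)| \<le> 2 |P| - 5\<close>. So five or fewer sites have at most as many vertices as sites, and fewer than five
  sites disappear after three steps. Five sites keep their number unless it drops below five at some step.

  The formula is Euler's formula for the Delaunay tessellation, whose polygons are spanned by the
  sites on an empty circle; their centres are the Voronoi vertices (\<open>voronoi_iteration_eq\<close>). Instead of
  counting edges and faces of a planar graph, or adding up angles, the proof fixes a direction \<open>d\<close>
  parallel to no line through two sites and counts the rays from sites in the directions \<open>d\<close> and
  \<open>- d\<close> that run into the convex hull.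

  Counted by sites, there are two such rays at each interior site, none at the two sites that are
  extreme in the coordinate transverse to \<open>d\<close>, and one at each remaining site. This gives
  \<open>|P| + |Int(P)| - 2\<close> (\<open>card_entered_sum\<close>). The same count for the \<open>k\<close> sites on an empty circle, none of which is
  inside their hull, gives \<open>k - 2\<close> (\<open>card_entered_sum_on_sphere\<close>). The two counts are linked by the fact that
  a ray into the hull of \<open>P\<close> runs at first through exactly one Delaunay polygon at its site
  (\<open>card_entered_by_vertices\<close>). That local tiling property is linear programming duality in the plane: the centre
  of the polygon's circle is the point of the Voronoi cell of the site that lies furthest in the direction
  of the ray (\<open>entering_vertex_exists\<close>, \<open>entering_vertex_unique\<close>). Hence the sum of \<open>k - 2\<close> over all empty
  circles is \<open>|P| + |Int(P)| - 2\<close>, and this sum is \<open>|\<nu>(P)| + I_c(P)\<close>.\<close>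

section \<open>Determinants and coordinates in the plane\<close>

definition wedge :: "real^2 \<Rightarrow> real^2 \<Rightarrow> real" where
  "wedge u v = u$1 * v$2 - u$2 * v$1"

lemma vec2_eq_iff: "(x::real^2) = y \<longleftrightarrow> x$1 = y$1 \<and> x$2 = y$2"
  by (simp add: vec_eq_iff forall_2)

lemma inner_vec2: "(x::real^2) \<bullet> y = x$1 * y$1 + x$2 * y$2"
  by (simp add: inner_vec_def sum_2)

lemma wedge_simps:
  "wedge u u = 0" "wedge 0 v = 0" "wedge u 0 = 0"
  "wedge (- u) v = - wedge u v"
  "wedge u (x + y) = wedge u x + wedge u y" "wedge u (x - y) = wedge u x - wedge u y"
  "wedge (x + y) u = wedge x u + wedge y u" "wedge (x - y) u = wedge x u - wedge y u"
  "wedge u (t *\<^sub>R x) = t * wedge u x" "wedge (t *\<^sub>R x) u = t * wedge x u"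
  by (simp_all add: wedge_def algebra_simps)

lemma wedge_commute: "wedge v u = - wedge u v"
  by (simp add: wedge_def)

text \<open>Cramer's rule in a form without division.\<close>

lemma wedge_cramer: "wedge u v *\<^sub>R x = wedge x v *\<^sub>R u + wedge u x *\<^sub>R v"
  by (simp add: vec2_eq_iff wedge_def algebra_simps)

lemma wedge_basis:
  assumes "wedge u v \<noteq> 0"
  obtains s t where "x = s *\<^sub>R u + t *\<^sub>R v"
proof
  have "x = (1 / wedge u v) *\<^sub>R (wedge u v *\<^sub>R x)" using assms by simp
  also have "\<dots> = (wedge x v / wedge u v) *\<^sub>R u + (wedge u x / wedge u v) *\<^sub>R v"
    unfolding wedge_cramer[of u v x] by (simp only: scaleR_add_right scaleR_scaleR) simp
  finally show "x = (wedge x v / wedge u v) *\<^sub>R u + (wedge u x / wedge u v) *\<^sub>R v" .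
qed

lemma wedge_eq_0_parallel:
  assumes "wedge u v = 0" "u \<noteq> 0"
  obtains c where "v = c *\<^sub>R u"
proof (cases "u$1 = 0")
  case True
  then have "v = (v$2 / u$2) *\<^sub>R u" using assms by (auto simp: vec2_eq_iff wedge_def)
  then show ?thesis by (rule that)
next
  case False
  then have "v = (v$1 / u$1) *\<^sub>R u" using assms by (auto simp: vec2_eq_iff wedge_def field_simps)
  then show ?thesis by (rule that)
qed

text \<open>This is what produces circumcentres: the centre of the circle through \<open>0\<close>, \<open>u\<close> and \<open>v\<close> is the vector
  whose inner products with \<open>u\<close> and \<open>v\<close> are half their squared lengths.\<close>

lemma wedge_dual:
  assumes "wedge u v \<noteq> 0"
  obtains z where "z \<bullet> u = s" "z \<bullet> v = t"
proof
  let ?z = "(1 / wedge u v) *\<^sub>R vector [s * v$2 - t * u$2, t * u$1 - s * v$1] :: real^2"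
  have "wedge u v * (?z \<bullet> u) = wedge u v * s" "wedge u v * (?z \<bullet> v) = wedge u v * t"
    using assms by (simp_all add: inner_vec2 vector_2 field_simps) (simp_all add: wedge_def algebra_simps)
  then show "?z \<bullet> u = s" "?z \<bullet> v = t" using assms by simp_all
qed

lemma orthogonal_to_basis_eq_0:
  assumes "wedge u v \<noteq> 0" "z \<bullet> u = 0" "z \<bullet> v = 0"
  shows "z = (0::real^2)"
proof -
  obtain s t where "z = s *\<^sub>R u + t *\<^sub>R v" using wedge_basis[OF assms(1)] .
  then have "z \<bullet> z = 0" using assms(2,3) by (metis inner_right_distrib inner_scaleR_right add_0 mult_zero_right)
  then show ?thesis by simp
qed

text \<open>\<open>wedge d\<close> is, up to scale, the coordinate orthogonal to \<open>d\<close>; it fails to be injective on \<open>P\<close> only if \<open>d\<close>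
  is parallel to one of the finitely many lines through two points of \<open>P\<close>.\<close>

lemma exists_generic_direction:
  assumes "finite (P :: (real^2) set)"
  obtains d where "d \<noteq> 0" "inj_on (wedge d) P"
proof -
  \<comment> \<open>The slopes to be avoided; the quotient is \<open>0\<close> for vertical pairs, which no \<open>(1, m)\<close> is parallel to.\<close>
  let ?S = "(\<lambda>(p,q). (p$2 - q$2) / (p$1 - q$1)) ` (P \<times> P)"
  have "finite ?S" using assms by simp
  then obtain m where m: "m \<notin> ?S" using ex_new_if_finite[OF infinite_UNIV_char_0] by blast
  define d :: "real^2" where "d = vector [1, m]"
  have d: "d$1 = 1" "d$2 = m" by (simp_all add: d_def vector_2)
  have "p = q" if "p \<in> P" "q \<in> P" "wedge d p = wedge d q" for p q
  proof -
    have eq: "p$2 - q$2 = m * (p$1 - q$1)" using that(3) by (simp add: wedge_def d algebra_simps)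
    have "p$1 = q$1"
    proof (rule ccontr)
      assume "p$1 \<noteq> q$1"
      then have "m = (p$2 - q$2) / (p$1 - q$1)" using eq by simp
      with m that show False by force
    qed
    with eq show "p = q" by (simp add: vec2_eq_iff)
  qed
  then have "inj_on (wedge d) P" by (auto intro: inj_onI)
  moreover have "d \<noteq> 0" using d(1) by auto
  ultimately show ?thesis using that by blast
qed

section \<open>Directions pointing into a finite set\<close>

text \<open>If \<open>d\<close> is parallel to no line through two points of \<open>S\<close>, then the ray from \<open>p\<close> in the direction \<open>d\<close> runs
  at first through the interior of a triangle \<open>p a b\<close>, hence through the convex hull of \<open>S\<close>. The conic
  combination is kept explicit because its coefficients are a feasible point of the linear program
  that locates the Delaunay polygon the ray enters.\<close>

definition enters :: "(real^2) set \<Rightarrow> real^2 \<Rightarrow> real^2 \<Rightarrow> bool" where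
  "enters S d p \<longleftrightarrow>
     (\<exists>a\<in>S. \<exists>b\<in>S. \<exists>s>0. \<exists>t>0. d = s *\<^sub>R (a - p) + t *\<^sub>R (b - p))"

lemma enters_mono: "enters S d p \<Longrightarrow> S \<subseteq> T \<Longrightarrow> enters T d p"
  unfolding enters_def by blast

lemma inj_on_wedge_uminus: "inj_on (wedge (- d)) P \<longleftrightarrow> inj_on (wedge d) P"
  by (simp add: inj_on_def wedge_simps)

text \<open>For a direction parallel to no line through two points of \<open>S\<close>, an entered triangle cannot be degenerate.\<close>

lemma entering_pair_independent:
  assumes "inj_on (wedge d) S" "d \<noteq> 0" "a \<in> S" "b \<in> S" "p \<in> S" "s > 0" "t > 0"
    and d: "d = s *\<^sub>R (a - p) + t *\<^sub>R (b - p)"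
  shows "wedge (a - p) (b - p) \<noteq> 0" "wedge d a \<noteq> wedge d p"
proof -
  show ap: "wedge d a \<noteq> wedge d p"
  proof
    assume "wedge d a = wedge d p"
    then have "a = p" using assms(1,3,5) by (auto dest: inj_onD)
    with d have d': "d = t *\<^sub>R (b - p)" by simp
    then have "t * wedge d (b - p) = 0" by (metis wedge_simps(1,9))
    then have "b = p" using assms(1,4,5,7) by (auto simp: wedge_simps dest: inj_onD)
    with d' \<open>d \<noteq> 0\<close> show False by simp
  qed
  have "wedge d (a - p) = t * wedge (b - p) (a - p)"
    using arg_cong[OF d, of "\<lambda>x. wedge x (a - p)"] by (simp only: wedge_simps(1,7,10))
  with ap show "wedge (a - p) (b - p) \<noteq> 0"
    using wedge_commute[of "b - p" "a - p"] by (auto simp: wedge_simps)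
qed

text \<open>The ray enters the triangle \<open>p a b\<close> when \<open>a\<close> and \<open>b\<close> lie on different sides of its line and the segment
  between them passes in front of \<open>p\<close> rather than behind; the orientation of the triangle tells which.\<close>

lemma enters_iff_wedge:
  assumes "inj_on (wedge d) S" "d \<noteq> 0" "p \<in> S"
  shows "enters S d p \<longleftrightarrow> (\<exists>a\<in>S. \<exists>b\<in>S. wedge d a < wedge d p \<and> wedge d p < wedge d b
            \<and> wedge (a - p) (b - p) > 0)" (is "_ \<longleftrightarrow> ?R")
proof
  assume "enters S d p"
  then obtain a b s t where ab: "a \<in> S" "b \<in> S" "s > 0" "t > 0"
    and d: "d = s *\<^sub>R (a - p) + t *\<^sub>R (b - p)" unfolding enters_def by blast
  have fa: "wedge d (a - p) = - t * wedge (a - p) (b - p)"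
    using arg_cong[OF d, of "\<lambda>x. wedge x (a - p)"] wedge_commute[of "b - p" "a - p"]
    by (simp only: wedge_simps(1,7,10))
  have fb: "wedge d (b - p) = s * wedge (a - p) (b - p)"
    using arg_cong[OF d, of "\<lambda>x. wedge x (b - p)"] by (simp only: wedge_simps(1,7,10))
  have "wedge (a - p) (b - p) \<noteq> 0"
    using entering_pair_independent(1)[OF assms(1,2) ab(1,2) assms(3) ab(3,4) d] .
  \<comment> \<open>The roles of \<open>a\<close> and \<open>b\<close> in the definition are symmetric, so they may need to be exchanged.\<close>
  then consider "wedge (a - p) (b - p) > 0" | "wedge (b - p) (a - p) > 0"
    using wedge_commute[of "b - p" "a - p"] by linarith
  then show ?R
  proof cases
    case 1
    then have "t * wedge (a - p) (b - p) > 0" "s * wedge (a - p) (b - p) > 0" using ab by simp_all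
    then have "wedge d a < wedge d p" "wedge d p < wedge d b"
      using fa fb by (simp_all only: wedge_simps(6))
    with 1 ab show ?thesis by blast
  next
    case 2
    then have "t * wedge (b - p) (a - p) > 0" "s * wedge (b - p) (a - p) > 0" using ab by simp_all
    moreover have "wedge d (a - p) = t * wedge (b - p) (a - p)" "wedge d (b - p) = - (s * wedge (b - p) (a - p))"
      using fa fb wedge_commute[of "b - p" "a - p"] by simp_all
    ultimately have "wedge d (b - p) < 0" "0 < wedge d (a - p)" by linarith+
    then have "wedge d b < wedge d p" "wedge d p < wedge d a" by (simp_all add: wedge_simps(6))
    with 2 ab show ?thesis by blast
  qed
next
  assume ?R
  then obtain a b where ab: "a \<in> S" "b \<in> S" "wedge d a < wedge d p" "wedge d p < wedge d b"
    and w: "wedge (a - p) (b - p) > 0" by blast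
  let ?w = "wedge (a - p) (b - p)"
  have "d = (1 / ?w) *\<^sub>R (?w *\<^sub>R d)" using w by simp
  also have "\<dots> = (wedge d (b - p) / ?w) *\<^sub>R (a - p) + (wedge (a - p) d / ?w) *\<^sub>R (b - p)"
    unfolding wedge_cramer[of "a - p" "b - p" d] by (simp only: scaleR_add_right scaleR_scaleR) simp
  finally have "d = (wedge d (b - p) / ?w) *\<^sub>R (a - p) + (wedge (a - p) d / ?w) *\<^sub>R (b - p)" .
  moreover have "wedge d (b - p) / ?w > 0" "wedge (a - p) d / ?w > 0"
    using ab w wedge_commute[of "a - p" d] by (simp_all add: wedge_simps(6))
  ultimately show "enters S d p" using ab unfolding enters_def by blast
qed

lemma enters_iff_wedge_uminus:
  assumes "inj_on (wedge d) S" "d \<noteq> 0" "p \<in> S"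
  shows "enters S (- d) p \<longleftrightarrow> (\<exists>a\<in>S. \<exists>b\<in>S. wedge d a < wedge d p \<and> wedge d p < wedge d b
            \<and> wedge (a - p) (b - p) < 0)"
proof -
  have "enters S (- d) p \<longleftrightarrow> (\<exists>a\<in>S. \<exists>b\<in>S. wedge d p < wedge d a \<and> wedge d b < wedge d p
            \<and> wedge (a - p) (b - p) > 0)"
    using enters_iff_wedge[of "-d" S p] assms by (simp add: inj_on_wedge_uminus wedge_simps(4))
  moreover have "wedge (a - p) (b - p) > 0 \<longleftrightarrow> wedge (b - p) (a - p) < 0" for a b
    using wedge_commute[of "a - p" "b - p"] by linarith
  ultimately show ?thesis by blast
qed

text \<open>If no segment between the two sides of the line through \<open>p\<close> passes before or behind \<open>p\<close>, then they all
  pass through \<open>p\<close>, and so all points lie on one line.\<close>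

lemma collinear_if_not_entered:
  assumes inj: "inj_on (wedge d) S" and d: "d \<noteq> 0" and p: "p \<in> S"
    and a0: "a0 \<in> S" "wedge d a0 < wedge d p" and b0: "b0 \<in> S" "wedge d p < wedge d b0"
    and no: "\<not> enters S d p" "\<not> enters S (- d) p"
  shows "collinear S"
proof -
  have flat: "wedge (a - p) (b - p) = 0"
    if "a \<in> S" "b \<in> S" "wedge d a < wedge d p" "wedge d p < wedge d b" for a b
    using no that unfolding enters_iff_wedge[OF inj d p] enters_iff_wedge_uminus[OF inj d p]
    by (meson linorder_neqE_linordered_idom)
  have u: "a0 - p \<noteq> 0" "b0 - p \<noteq> 0" using a0 b0 by auto
  have on_line: "\<exists>c. x - p = c *\<^sub>R (b0 - p)" if x: "x \<in> S" for x
  proof -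
    consider "wedge d x < wedge d p" | "x = p" | "wedge d p < wedge d x"
      using inj p x by (meson inj_onD linorder_neqE_linordered_idom)
    then show ?thesis
    proof cases
      case 1
      then have "wedge (b0 - p) (x - p) = 0" using flat[of x b0] x b0 wedge_commute[of "b0 - p"] by simp
      then show ?thesis using wedge_eq_0_parallel u by metis
    next
      case 2
      then show ?thesis by (intro exI[of _ 0]) simp
    next
      case 3
      have "wedge (a0 - p) (x - p) = 0" "wedge (a0 - p) (b0 - p) = 0"
        using flat 3 x a0 b0 by simp_all
      then obtain s t where st: "x - p = s *\<^sub>R (a0 - p)" "b0 - p = t *\<^sub>R (a0 - p)"
        using wedge_eq_0_parallel u by metis
      then have "t \<noteq> 0" using u by auto
      then have "x - p = (s / t) *\<^sub>R (b0 - p)" using st by simp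
      then show ?thesis by blast
    qed
  qed
  show ?thesis unfolding collinear_def
  proof (intro exI[of _ "b0 - p"] ballI)
    fix x y assume "x \<in> S" "y \<in> S"
    then obtain s t where "x - p = s *\<^sub>R (b0 - p)" "y - p = t *\<^sub>R (b0 - p)" using on_line by meson
    moreover have "x - y = (x - p) - (y - p)" by simp
    ultimately have "x - y = (s - t) *\<^sub>R (b0 - p)" by (simp only: scaleR_diff_left)
    then show "\<exists>c. x - y = c *\<^sub>R (b0 - p)" by blast
  qed
qed

text \<open>Only the two points of \<open>S\<close> that are extreme in the coordinate \<open>wedge d\<close> lack points on one side, so
  they are the only points from which neither \<open>d\<close> nor \<open>- d\<close> leads into \<open>S\<close>.\<close>

lemma card_entered:
  assumes fin: "finite S" and nc: "\<not> collinear S" and inj: "inj_on (wedge d) S" and d: "d \<noteq> 0"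
  shows "card {p \<in> S. enters S d p \<or> enters S (- d) p} + 2 = card S"
proof -
  have ne: "S \<noteq> {}" using nc by auto
  have "Min (wedge d ` S) \<in> wedge d ` S" "Max (wedge d ` S) \<in> wedge d ` S"
    using fin ne by simp_all
  then obtain l r where lr: "l \<in> S" "wedge d l = Min (wedge d ` S)" "r \<in> S" "wedge d r = Max (wedge d ` S)"
    by (metis imageE)
  have l: "wedge d l \<le> wedge d x" and r: "wedge d x \<le> wedge d r" if "x \<in> S" for x
    using that fin lr by simp_all
  have "l \<noteq> r"
  proof
    assume "l = r"
    then have "wedge d x = wedge d l" if "x \<in> S" for x using l[OF that] r[OF that] by simp
    then have "S \<subseteq> {l}" using inj lr(1) by (auto dest: inj_onD)
    then show False using nc collinear_subset[OF collinear_sing] by blast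
  qed
  have "{p \<in> S. enters S d p \<or> enters S (- d) p} = S - {l, r}"
  proof (intro set_eqI iffI)
    fix p assume p: "p \<in> {p \<in> S. enters S d p \<or> enters S (- d) p}"
    then have "\<exists>a\<in>S. \<exists>b\<in>S. wedge d a < wedge d p \<and> wedge d p < wedge d b"
      using enters_iff_wedge[OF inj d, of p] enters_iff_wedge_uminus[OF inj d, of p] by blast
    then show "p \<in> S - {l, r}" using l r p by force
  next
    fix p assume p: "p \<in> S - {l, r}"
    then have "wedge d l < wedge d p" "wedge d p < wedge d r"
      using l[of p] r[of p] lr(1,3) inj by (auto simp: order_less_le inj_on_eq_iff)
    then have "enters S d p \<or> enters S (- d) p"
      using collinear_if_not_entered[OF inj d, of p l r] nc lr p by blast
    then show "p \<in> {p \<in> S. enters S d p \<or> enters S (- d) p}" using p by simp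
  qed
  moreover have "card {l, r} \<le> card S" using lr fin by (intro card_mono) auto
  ultimately show ?thesis using lr fin \<open>l \<noteq> r\<close> by (simp add: card_Diff_subset)
qed

section \<open>Interior points are entered from both sides\<close>

lemma supporting_not_interior:
  assumes "n \<noteq> 0" "\<And>x. x \<in> P \<Longrightarrow> n \<bullet> x \<le> n \<bullet> p"
  shows "p \<notin> interior (convex hull P)"
proof
  assume "p \<in> interior (convex hull P)"
  moreover have "convex hull P \<subseteq> {x. n \<bullet> x \<le> n \<bullet> p}"
    using assms(2) by (intro hull_minimal) (auto simp: convex_halfspace_le)
  ultimately have "p \<in> interior {x. n \<bullet> x \<le> n \<bullet> p}" using interior_mono by blast
  then show False using interior_halfspace_le[OF assms(1)] by auto
qed

lemma supporting_if_not_interior: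
  fixes P :: "(real^2) set"
  assumes "\<not> collinear P" "p \<in> P" "p \<notin> interior (convex hull P)"
  obtains n where "n \<noteq> 0" "\<And>x. x \<in> P \<Longrightarrow> n \<bullet> p \<le> n \<bullet> x"
proof -
  have "aff_dim (convex hull P) = DIM(real^2)"
    using assms(1) aff_dim_le_DIM[of P] by (simp add: aff_dim_convex_hull collinear_aff_dim)
  then have "rel_interior (convex hull P) = interior (convex hull P)"
    by (simp add: interior_rel_interior)
  then show ?thesis
    using supporting_hyperplane_rel_boundary[of "convex hull P" p] assms(2,3) that
    by (metis convex_convex_hull hull_inc)
qed

lemma Int_pts_eq: "Int_pts P = P \<inter> interior (convex hull P)"
proof -
  have "P \<subseteq> closure (convex hull P)" using hull_subset[of P convex] closure_subset by blast
  then show ?thesis unfolding Int_pts_def Bd_def frontier_def by blast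
qed

text \<open>If \<open>d\<close> does not enter, then a line through \<open>p\<close> has all of \<open>P\<close> on one side: rotate the ray \<open>d\<close> towards the
  side of larger \<open>wedge d\<close> until it first meets a point \<open>b0\<close>; if there is no point on that side, the line
  of the ray itself serves. A point on the other side of the ray and in front of the line through \<open>p\<close>
  and \<open>b0\<close> would span with \<open>b0\<close> a segment passing in front of \<open>p\<close>.\<close>

lemma entered_if_interior:
  assumes fin: "finite P" and inj: "inj_on (wedge d) P" and d: "d \<noteq> 0"
    and p: "p \<in> P" "p \<in> interior (convex hull P)"
  shows "enters P d p"
proof (rule ccontr)
  assume no: "\<not> enters P d p"
  define R where "R = {b \<in> P. wedge d p < wedge d b}"
  obtain n :: "real^2" where n: "n \<noteq> 0" "\<forall>x\<in>P. n \<bullet> x \<le> n \<bullet> p"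
  proof (cases "R = {}")
    case True
    have eq: "vector [- d$2, d$1] \<bullet> x = wedge d x" for x
      by (simp add: inner_vec2 wedge_def vector_2)
    show ?thesis
    proof (rule that[of "vector [- d$2, d$1]"])
      show "(vector [- d$2, d$1] :: real^2) \<noteq> 0" using d by (auto simp: vec2_eq_iff vector_2)
      show "\<forall>x\<in>P. vector [- d$2, d$1] \<bullet> x \<le> vector [- d$2, d$1] \<bullet> p"
        unfolding eq using True by (auto simp: R_def not_less)
    qed
  next
    case False
    \<comment> \<open>Maximal slope means smallest angle with \<open>d\<close> among the points of \<open>R\<close>.\<close>
    define slope where "slope x = (d \<bullet> (x - p)) / wedge d (x - p)" for x
    have "finite R" using fin by (simp add: R_def)
    then have "Max (slope ` R) \<in> slope ` R" using False by simp
    then obtain b0 where b0: "b0 \<in> R" "slope b0 = Max (slope ` R)" by auto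
    have max: "slope b \<le> slope b0" if "b \<in> R" for b using \<open>finite R\<close> that b0(2) by simp
    have pos: "wedge d (b - p) > 0" if "b \<in> R" for b using that by (simp add: R_def wedge_simps)
    have ident: "(d \<bullet> d) * wedge x y = (d \<bullet> x) * wedge d y - wedge d x * (d \<bullet> y)" for x y
      by (simp add: inner_vec2 wedge_def algebra_simps)
    have dd: "d \<bullet> d > 0" using d by simp
    have side: "wedge (x - p) (b0 - p) \<le> 0" if x: "x \<in> P" for x
    proof -
      consider "x = p" | "wedge d x < wedge d p" | "x \<in> R"
        using x p inj by (auto simp: R_def inj_on_def) (meson linorder_neqE_linordered_idom)
      then show ?thesis
      proof cases
        case 1 then show ?thesis by (simp add: wedge_simps)
      next
        case 2
        then show ?thesis
          using no x b0(1) unfolding enters_iff_wedge[OF inj d p(1)] R_def by force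
      next
        case 3
        have "(d \<bullet> (x - p)) * wedge d (b0 - p) \<le> wedge d (x - p) * (d \<bullet> (b0 - p))"
          using max[OF 3] pos[OF 3] pos[OF b0(1)] unfolding slope_def by (simp add: divide_simps mult.commute)
        then have "(d \<bullet> d) * wedge (x - p) (b0 - p) \<le> 0" unfolding ident by simp
        then show ?thesis using dd by (simp add: mult_le_0_iff)
      qed
    qed
    let ?v = "b0 - p"
    let ?n = "vector [?v$2, - ?v$1] :: real^2"
    have eq: "?n \<bullet> x = wedge x ?v" for x
      by (simp add: inner_vec2 wedge_def vector_2 algebra_simps)
    show ?thesis
    proof (rule that[of ?n])
      have "?v \<noteq> 0" using b0(1) by (auto simp: R_def)
      then show "?n \<noteq> 0" by (auto simp: vec2_eq_iff vector_2)
      show "\<forall>x\<in>P. ?n \<bullet> x \<le> ?n \<bullet> p"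
        unfolding eq using side by (simp add: wedge_simps(8))
    qed
  qed
  with p(2) show False using supporting_not_interior[of n P p] by blast
qed

text \<open>A linear functional that is nonnegative on the two edges of the entered triangle, and not positive
  on the positive combination \<open>d\<close> of them, vanishes on both edges. This serves once to exclude supporting
  lines at interior points and once to show that two Voronoi vertices coincide.\<close>

lemma orthogonal_to_entering_pair:
  assumes inj: "inj_on (wedge d) S" "d \<noteq> 0" "p \<in> S" and "enters S d p"
    and n: "\<And>x. x \<in> S \<Longrightarrow> 0 \<le> n \<bullet> (x - p)" "n \<bullet> d \<le> 0"
  shows "n = 0"
proof -
  obtain a b s t where ab: "a \<in> S" "b \<in> S" "s > 0" "t > 0"
    and d: "d = s *\<^sub>R (a - p) + t *\<^sub>R (b - p)" using assms(4) unfolding enters_def by blast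
  have "s * (n \<bullet> (a - p)) + t * (n \<bullet> (b - p)) \<le> 0" using n(2) by (simp add: d inner_right_distrib)
  moreover have "s * (n \<bullet> (a - p)) \<ge> 0" "t * (n \<bullet> (b - p)) \<ge> 0" using ab n(1) by simp_all
  ultimately have "s * (n \<bullet> (a - p)) = 0" "t * (n \<bullet> (b - p)) = 0" by linarith+
  then have "n \<bullet> (a - p) = 0" "n \<bullet> (b - p) = 0" using ab by simp_all
  then show ?thesis
    using orthogonal_to_basis_eq_0 entering_pair_independent(1)[OF inj(1,2) ab(1,2) inj(3) ab(3,4) d] by blast
qed

lemma interior_iff_entered_twice:
  assumes fin: "finite P" and nc: "\<not> collinear P" and inj: "inj_on (wedge d) P" and d: "d \<noteq> 0"
    and p: "p \<in> P"
  shows "p \<in> interior (convex hull P) \<longleftrightarrow> enters P d p \<and> enters P (- d) p"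
proof
  assume "p \<in> interior (convex hull P)"
  then show "enters P d p \<and> enters P (- d) p"
    using entered_if_interior[OF fin _ _ p] inj d by (simp add: inj_on_wedge_uminus)
next
  assume en: "enters P d p \<and> enters P (- d) p"
  show "p \<in> interior (convex hull P)"
  proof (rule ccontr)
    assume "p \<notin> interior (convex hull P)"
    then obtain n where n: "n \<noteq> 0" "\<And>x. x \<in> P \<Longrightarrow> n \<bullet> p \<le> n \<bullet> x"
      using supporting_if_not_interior[OF nc p] by metis
    have n': "0 \<le> n \<bullet> (x - p)" if "x \<in> P" for x using n(2)[OF that] by (simp add: inner_diff_right)
    consider "n \<bullet> d \<le> 0" | "n \<bullet> (- d) \<le> 0" by fastforce
    then show False
    proof cases
      case 1 then show False using orthogonal_to_entering_pair[OF inj d p] en n' n(1) by blast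
    next
      case 2 then show False
        using orthogonal_to_entering_pair[of "- d" P p n] inj d p en n' n(1)
        by (simp add: inj_on_wedge_uminus)
    qed
  qed
qed

text \<open>Inclusion and exclusion: interior points are counted twice, the two extreme points not at all, and
  every other point once.\<close>

lemma card_entered_sum:
  assumes fin: "finite P" and nc: "\<not> collinear P" and inj: "inj_on (wedge d) P" and d: "d \<noteq> 0"
  shows "card {p \<in> P. enters P d p} + card {p \<in> P. enters P (- d) p} + 2 = card P + card (Int_pts P)"
proof -
  let ?A = "{p \<in> P. enters P d p}" and ?B = "{p \<in> P. enters P (- d) p}"
  have "card ?A + card ?B = card (?A \<union> ?B) + card (?A \<inter> ?B)"
    using fin by (intro card_Un_Int) auto
  moreover have "?A \<union> ?B = {p \<in> P. enters P d p \<or> enters P (- d) p}" by blast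
  moreover have "?A \<inter> ?B = Int_pts P"
    unfolding Int_pts_eq using interior_iff_entered_twice[OF assms] by blast
  ultimately show ?thesis using card_entered[OF assms] by simp
qed

section \<open>Point sets on a circle\<close>

text \<open>The circle through \<open>p\<close> with centre \<open>c\<close>, seen from \<open>p\<close>. The linear dependence on \<open>c\<close> turns the search for
  circles through \<open>p\<close> with no site inside into a linear program.\<close>

lemma inner_from_sphere_point:
  fixes p a c :: "'a::real_inner"
  assumes "p \<in> sphere c r" "a \<in> sphere c r"
  shows "2 * ((c - p) \<bullet> (a - p)) = (a - p) \<bullet> (a - p)"
proof -
  have "(p - c) \<bullet> (p - c) = (a - c) \<bullet> (a - c)"
    using assms by (metis dist_commute dist_norm dot_square_norm mem_sphere)
  then show ?thesis by (simp add: inner_diff_left inner_diff_right inner_commute)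
qed

text \<open>Along a line through the sphere point \<open>p\<close>, the equation of the sphere is quadratic with root \<open>0\<close>, so it
  has at most one other root.\<close>

lemma collinear_sphere_card_le_2:
  fixes S :: "'a::euclidean_space set"
  assumes "S \<subseteq> sphere c r" "collinear S"
  shows "card S \<le> 2"
proof (rule ccontr)
  assume "\<not> card S \<le> 2"
  then obtain T where "T \<subseteq> S" "card T = 3" using obtain_subset_with_card_n[of 3 S] by force
  then obtain p a b where pab: "p \<in> S" "a \<in> S" "b \<in> S" "p \<noteq> a" "p \<noteq> b" "a \<noteq> b"
    unfolding card_3_iff by blast
  obtain u where u: "\<And>x y. x \<in> S \<Longrightarrow> y \<in> S \<Longrightarrow> \<exists>k. x - y = k *\<^sub>R u"
    using assms(2) unfolding collinear_def by blast
  obtain s t where st: "a - p = s *\<^sub>R u" "b - p = t *\<^sub>R u" using u pab by meson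
  have "s \<noteq> 0" "t \<noteq> 0" "u \<noteq> 0" using st pab by auto
  have "2 * ((c - p) \<bullet> u) = k * (u \<bullet> u)" if "x \<in> S" "x - p = k *\<^sub>R u" "k \<noteq> 0" for x k
    using inner_from_sphere_point[of p c r x] assms(1) pab(1) that by (simp add: subset_iff)
  from this[OF pab(2) st(1)] this[OF pab(3) st(2)]
  have "s * (u \<bullet> u) = t * (u \<bullet> u)" using \<open>s \<noteq> 0\<close> \<open>t \<noteq> 0\<close> by metis
  then have "s = t" using \<open>u \<noteq> 0\<close> by (metis inner_eq_zero_iff mult_right_cancel)
  then have "a - p = b - p" using st by simp
  then show False using pab by simp
qed

text \<open>Differences of common points are orthogonal to the line of centres, so the common points are collinear.\<close>

lemma two_circles_card_le_2:
  fixes c c' :: "real^2"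
  assumes "S \<subseteq> sphere c r" "S \<subseteq> sphere c' r'" "c \<noteq> c'"
  shows "card S \<le> 2"
proof (rule collinear_sphere_card_le_2[OF assms(1)])
  let ?u = "vector [- (c' - c)$2, (c' - c)$1] :: real^2"
  show "collinear S" unfolding collinear_def
  proof (intro exI[of _ ?u] ballI)
    fix x y assume "x \<in> S" "y \<in> S"
    then have "2 * ((c - y) \<bullet> (x - y)) = 2 * ((c' - y) \<bullet> (x - y))"
      using inner_from_sphere_point[of y c r x] inner_from_sphere_point[of y c' r' x] assms(1,2)
      by (simp add: subset_iff)
    then have "(c' - c) \<bullet> (x - y) = 0" by (simp add: inner_diff_left)
    moreover have "wedge ?u (x - y) = - ((c' - c) \<bullet> (x - y))"
      by (simp add: inner_vec2 wedge_def vector_2 algebra_simps)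
    ultimately have "wedge ?u (x - y) = 0" by simp
    moreover have "?u \<noteq> 0" using assms(3) by (auto simp: vec2_eq_iff vector_2)
    ultimately show "\<exists>k. x - y = k *\<^sub>R ?u" using wedge_eq_0_parallel by metis
  qed
qed

text \<open>Every chord from \<open>p\<close> has positive inner product with the inner normal \<open>c - p\<close>, hence so does every
  direction that enters; \<open>d\<close> and \<open>- d\<close> cannot both have it.\<close>

lemma not_entered_twice_on_sphere:
  assumes "S \<subseteq> sphere c r" "p \<in> S" "d \<noteq> 0"
  shows "\<not> (enters S d p \<and> enters S (- d) p)"
proof
  assume en: "enters S d p \<and> enters S (- d) p"
  have pos: "(c - p) \<bullet> e > 0" if "enters S e p" "e \<noteq> 0" for e :: "real^2"
  proof -
    obtain a b s t where ab: "a \<in> S" "b \<in> S" "s > 0" "t > 0"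
      and e: "e = s *\<^sub>R (a - p) + t *\<^sub>R (b - p)" using \<open>enters S e p\<close> unfolding enters_def by blast
    have a: "2 * ((c - p) \<bullet> (a - p)) = (a - p) \<bullet> (a - p)"
      and b: "2 * ((c - p) \<bullet> (b - p)) = (b - p) \<bullet> (b - p)"
      using inner_from_sphere_point[of p c r a] inner_from_sphere_point[of p c r b] assms(1,2) ab
      by (simp_all add: subset_iff)
    have "2 * ((c - p) \<bullet> e) = s * (2 * ((c - p) \<bullet> (a - p))) + t * (2 * ((c - p) \<bullet> (b - p)))"
      by (simp add: e inner_right_distrib)
    also have "\<dots> = s * ((a - p) \<bullet> (a - p)) + t * ((b - p) \<bullet> (b - p))" unfolding a b ..
    also have "\<dots> > 0"
    proof -
      have "a - p \<noteq> 0 \<or> b - p \<noteq> 0" using that(2) e by auto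
      then show ?thesis using ab by (auto intro: add_pos_nonneg add_nonneg_pos)
    qed
    finally show ?thesis by simp
  qed
  from pos[of d] pos[of "- d"] en assms(3) show False by simp
qed

text \<open>The count for one Delaunay polygon: a polygon inscribed in a circle has no points inside its hull.\<close>

lemma card_entered_sum_on_sphere:
  assumes fin: "finite S" and S: "S \<subseteq> sphere c r" "3 \<le> card S"
    and inj: "inj_on (wedge d) S" and d: "d \<noteq> 0"
  shows "card {p \<in> S. enters S d p} + card {p \<in> S. enters S (- d) p} + 2 = card S"
proof -
  let ?A = "{p \<in> S. enters S d p}" and ?B = "{p \<in> S. enters S (- d) p}"
  have "\<not> collinear S" using collinear_sphere_card_le_2[OF S(1)] S(2) by auto
  moreover have "card (?A \<union> ?B) = card ?A + card ?B"
    using fin not_entered_twice_on_sphere[OF S(1) _ d] by (intro card_Un_disjoint) auto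
  moreover have "?A \<union> ?B = {p \<in> S. enters S d p \<or> enters S (- d) p}" by blast
  ultimately show ?thesis using card_entered[OF fin _ inj d] by simp
qed

section \<open>Voronoi vertices as centres of empty circles\<close>

text \<open>For a Voronoi vertex \<open>c\<close> this is the vertex set of the Delaunay polygon dual to \<open>c\<close>.\<close>

definition nearest :: "(real^2) set \<Rightarrow> real^2 \<Rightarrow> (real^2) set" where
  "nearest P c = {p \<in> P. \<forall>q\<in>P. dist c p \<le> dist c q}"

lemma nearest_subset: "nearest P c \<subseteq> P"
  by (auto simp: nearest_def)

lemma nearest_subset_sphere:
  assumes "p \<in> nearest P c"
  shows "nearest P c \<subseteq> sphere c (dist c p)"
  using assms by (auto simp: nearest_def intro!: antisym)

lemma nearest_eq_sphere:
  assumes "p \<in> nearest P c"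
  shows "nearest P c = sphere c (dist c p) \<inter> P"
  using assms by (auto simp: nearest_def intro!: antisym)

lemma center_unique:
  assumes "3 \<le> card (nearest P c)" "nearest P c \<subseteq> nearest P c'"
  shows "c = c'"
proof (rule ccontr)
  assume "c \<noteq> c'"
  obtain p where p: "p \<in> nearest P c" using assms(1) by fastforce
  then have "nearest P c \<subseteq> sphere c (dist c p)" "nearest P c \<subseteq> sphere c' (dist c' p)"
    using nearest_subset_sphere[of p P c] nearest_subset_sphere[of p P c'] assms(2) by blast+
  from two_circles_card_le_2[OF this \<open>c \<noteq> c'\<close>] show False using assms(1) by simp
qed

text \<open>A point lies in the cell of \<open>p\<close> exactly if \<open>p\<close> is nearest to it, and distinct sites have distinct cells.
  Three cells meet in at most one point because a point common to them is the centre of a circle through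
  their three sites.\<close>

lemma voronoi_iteration_eq:
  assumes fin: "finite P"
  shows "voronoi_iteration P = {c. 3 \<le> card (nearest P c)}"
proof (intro set_eqI iffI)
  fix c assume "c \<in> voronoi_iteration P"
  then obtain F where F: "F \<subseteq> voronoi_tessellation P" "3 \<le> card F" "\<Inter>F = {c}"
    unfolding voronoi_iteration_def voronoi_vertex_def by auto
  have "F \<subseteq> voronoi_polygon P ` nearest P c"
  proof
    fix V assume V: "V \<in> F"
    then obtain p where p: "p \<in> P" "V = voronoi_polygon P p"
      using F(1) unfolding voronoi_tessellation_def by auto
    have "c \<in> V" using F(3) V by auto
    then have "p \<in> nearest P c" using p by (simp add: voronoi_polygon_def nearest_def dist_norm norm_minus_commute)
    with p show "V \<in> voronoi_polygon P ` nearest P c" by blast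
  qed
  then have "card F \<le> card (nearest P c)"
    using surj_card_le fin finite_subset[OF nearest_subset] by metis
  with F(2) show "c \<in> {c. 3 \<le> card (nearest P c)}" by simp
next
  fix c assume "c \<in> {c. 3 \<le> card (nearest P c)}"
  then have c: "3 \<le> card (nearest P c)" by simp
  let ?F = "voronoi_polygon P ` nearest P c"
  have mem: "x \<in> voronoi_polygon P p \<longleftrightarrow> p \<in> nearest P x" if "p \<in> P" for x p
    using that by (simp add: voronoi_polygon_def nearest_def dist_norm norm_minus_commute)
  have "inj_on (voronoi_polygon P) P"
  proof (rule inj_onI)
    fix p q assume pq: "p \<in> P" "q \<in> P" "voronoi_polygon P p = voronoi_polygon P q"
    have "p \<in> nearest P p" using pq(1) by (simp add: nearest_def)
    then have "q \<in> nearest P p" using mem pq by metis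
    then have "dist p q \<le> dist p p" unfolding nearest_def using pq(1) by blast
    then show "p = q" by simp
  qed
  then have "card ?F = card (nearest P c)"
    by (intro card_image inj_on_subset[OF _ nearest_subset])
  moreover have "\<Inter>?F = {c}"
  proof (intro set_eqI iffI)
    fix x assume "x \<in> \<Inter>?F"
    then have "nearest P c \<subseteq> nearest P x" using mem nearest_subset[of P c] by blast
    then show "x \<in> {c}" using center_unique[OF c] by blast
  next
    fix x assume "x \<in> {c}"
    then show "x \<in> \<Inter>?F" using mem nearest_subset[of P c] by blast
  qed
  moreover have "?F \<subseteq> voronoi_tessellation P"
    unfolding voronoi_tessellation_def using nearest_subset by blast
  ultimately show "c \<in> voronoi_iteration P"
    unfolding voronoi_iteration_def voronoi_vertex_def using c by (intro CollectI exI[of _ ?F]) simp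
qed

text \<open>A Voronoi vertex is determined by the set of its nearest sites.\<close>

lemma finite_voronoi_iteration:
  assumes "finite P"
  shows "finite (voronoi_iteration P)"
proof (rule finite_imageD)
  show "finite (nearest P ` voronoi_iteration P)"
    using assms finite_subset[of _ "Pow P"] nearest_subset by (metis Pow_iff finite_Pow_iff image_subsetI)
  show "inj_on (nearest P) (voronoi_iteration P)"
    unfolding voronoi_iteration_eq[OF assms] by (auto intro!: inj_onI center_unique)
qed

lemma voronoi_iteration_collinear:
  assumes "finite P" "collinear P"
  shows "voronoi_iteration P = {}"
proof -
  have False if c: "3 \<le> card (nearest P c)" for c
  proof -
    obtain p where "p \<in> nearest P c" using c by fastforce
    then have "card (nearest P c) \<le> 2"
      using collinear_sphere_card_le_2[OF nearest_subset_sphere]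
        collinear_subset[OF assms(2) nearest_subset] by blast
    with c show False by simp
  qed
  then show ?thesis unfolding voronoi_iteration_eq[OF assms(1)] by blast
qed

text \<open>This transfers the sum over circles, taken as point sets, to a sum over Voronoi vertices.\<close>

lemma bij_empty_circles:
  assumes fin: "finite P"
  obtains C where "bij_betw C (voronoi_iteration P) (empty_circles P)"
    "\<forall>c\<in>voronoi_iteration P. C c \<inter> P = nearest P c"
proof
  let ?C = "\<lambda>c. sphere c (infdist c P)"
  have rad: "infdist c P = dist c p" if "p \<in> nearest P c" for c p
  proof -
    have p: "p \<in> P" "\<And>q. q \<in> P \<Longrightarrow> dist c p \<le> dist c q"
      using \<open>p \<in> nearest P c\<close> by (simp_all add: nearest_def)
    obtain q where "q \<in> P" "infdist c P = dist c q"
      using infdist_attains_inf[of P c] finite_imp_closed[OF fin] p(1) by blast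
    then show ?thesis using infdist_le[OF p(1), of c] p(2) by force
  qed
  have CP: "?C c \<inter> P = nearest P c" if c: "c \<in> voronoi_iteration P" for c
  proof -
    obtain p where p: "p \<in> nearest P c" using c unfolding voronoi_iteration_eq[OF fin] by fastforce
    show ?thesis using nearest_eq_sphere[OF p] rad[OF p] by simp
  qed
  then show "\<forall>c\<in>voronoi_iteration P. ?C c \<inter> P = nearest P c" by blast
  have "inj_on ?C (voronoi_iteration P)"
  proof (rule inj_onI)
    fix c c' assume c: "c \<in> voronoi_iteration P" "c' \<in> voronoi_iteration P" and "?C c = ?C c'"
    then have "nearest P c = nearest P c'" using CP by metis
    then show "c = c'" using center_unique c unfolding voronoi_iteration_eq[OF fin] by blast
  qed
  moreover have "?C ` voronoi_iteration P = empty_circles P"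
  proof (intro set_eqI iffI)
    fix S assume "S \<in> ?C ` voronoi_iteration P"
    then obtain c where c: "c \<in> voronoi_iteration P" and S: "S = ?C c" by blast
    have card: "3 \<le> card (nearest P c)" using c unfolding voronoi_iteration_eq[OF fin] by simp
    then obtain p where p: "p \<in> nearest P c" by fastforce
    have "dist c p \<noteq> 0"
    proof
      assume "dist c p = 0"
      then have "nearest P c \<subseteq> {c}" using nearest_subset_sphere[OF p] by simp
      then have "card (nearest P c) \<le> 1" using card_mono[of "{c}"] by fastforce
      with card show False by simp
    qed
    then have "infdist c P > 0" using rad[OF p] by simp
    moreover have "ball c (infdist c P) \<inter> P = {}"
      unfolding rad[OF p] using p by (force simp: nearest_def)
    moreover have "3 \<le> card (S \<inter> P)" using CP[OF c] card S by simp
    ultimately show "S \<in> empty_circles P" unfolding empty_circles_def S by blast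
  next
    fix S assume "S \<in> empty_circles P"
    then obtain c r where S: "S = sphere c r" and r: "ball c r \<inter> P = {}" "3 \<le> card (S \<inter> P)"
      unfolding empty_circles_def by blast
    have far: "r \<le> dist c q" if "q \<in> P" for q using r(1) that by (force simp: not_less[symmetric])
    have sub: "S \<inter> P \<subseteq> nearest P c" using far by (auto simp: S nearest_def)
    have "S \<inter> P \<noteq> {}" using r(2) by auto
    then obtain p where p: "p \<in> S \<inter> P" by blast
    then have "infdist c P = r" using rad[of p c] sub by (auto simp: S)
    moreover have "3 \<le> card (nearest P c)"
      using r(2) card_mono[OF finite_subset[OF nearest_subset fin] sub] by simp
    ultimately show "S \<in> ?C ` voronoi_iteration P" unfolding voronoi_iteration_eq[OF fin] S by blast
  qed
  ultimately show "bij_betw ?C (voronoi_iteration P) (empty_circles P)" unfolding bij_betw_def by blast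
qed

section \<open>The Delaunay polygon entered by a ray\<close>

lemma nearest_iff_inner:
  assumes "p \<in> P"
  shows "p \<in> nearest P c \<longleftrightarrow> (\<forall>q\<in>P. 2 * ((c - p) \<bullet> (q - p)) \<le> (q - p) \<bullet> (q - p))"
proof -
  have "dist c p \<le> dist c q \<longleftrightarrow> 2 * ((c - p) \<bullet> (q - p)) \<le> (q - p) \<bullet> (q - p)" for q
  proof -
    have "dist c p \<le> dist c q \<longleftrightarrow> (c - p) \<bullet> (c - p) \<le> (c - q) \<bullet> (c - q)"
      by (simp add: dist_norm norm_le)
    also have "\<dots> \<longleftrightarrow> 2 * ((c - p) \<bullet> (q - p)) \<le> (q - p) \<bullet> (q - p)"
      by (simp add: inner_diff_left inner_diff_right inner_commute) argo
    finally show ?thesis .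
  qed
  then show ?thesis using assms by (simp add: nearest_def)
qed

lemma nearest_if_inner_eq:
  assumes "p \<in> nearest P c" "a \<in> P" "2 * ((c - p) \<bullet> (a - p)) = (a - p) \<bullet> (a - p)"
  shows "a \<in> nearest P c"
proof -
  have "dist c a = dist c p"
  proof -
    have "(c - a) \<bullet> (c - a) = (c - p) \<bullet> (c - p)"
      using assms(3) by (simp add: inner_diff_left inner_diff_right inner_commute)
    then show ?thesis by (simp add: dist_norm norm_eq)
  qed
  with assms(1,2) show ?thesis by (simp add: nearest_def)
qed

text \<open>One step of the simplex method: the vector \<open>x\<close> is brought into the basis \<open>u\<close>, \<open>v\<close> at the expense of \<open>u\<close>.
  The ratio test keeps the coefficient of \<open>v\<close> nonnegative, and the cost drops because \<open>x\<close> costs less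
  than the combination of \<open>u\<close> and \<open>v\<close> that it replaces.\<close>

lemma pivot_decreases_cost:
  fixes u v x d :: "'a::real_inner"
  assumes d: "d = \<alpha> *\<^sub>R u + \<beta> *\<^sub>R v" and pos: "\<alpha> > 0" "\<beta> > 0"
    and x: "x = \<xi> *\<^sub>R u + \<eta> *\<^sub>R v" and \<xi>: "\<xi> > 0" and ratio: "\<alpha> * \<eta> \<le> \<beta> * \<xi>"
    and cheap: "x \<bullet> x < \<xi> * (u \<bullet> u) + \<eta> * (v \<bullet> v)"
  obtains s t where "s \<ge> 0" "t > 0" "d = s *\<^sub>R v + t *\<^sub>R x"
    "s * (v \<bullet> v) + t * (x \<bullet> x) < \<alpha> * (u \<bullet> u) + \<beta> * (v \<bullet> v)"
proof
  let ?t = "\<alpha> / \<xi>"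
  let ?s = "\<beta> - ?t * \<eta>"
  show "?t > 0" using pos \<xi> by simp
  show "?s \<ge> 0" using ratio \<xi> by (simp add: field_simps)
  show "d = ?s *\<^sub>R v + ?t *\<^sub>R x"
    using \<xi> by (simp add: d x scaleR_add_right scaleR_diff_left)
  have "?t * (x \<bullet> x) < ?t * (\<xi> * (u \<bullet> u) + \<eta> * (v \<bullet> v))"
    using cheap \<open>?t > 0\<close> by (rule mult_strict_left_mono)
  also have "\<dots> = \<alpha> * (u \<bullet> u) + ?t * \<eta> * (v \<bullet> v)" using \<xi> by (simp add: distrib_left)
  finally show "?s * (v \<bullet> v) + ?t * (x \<bullet> x) < \<alpha> * (u \<bullet> u) + \<beta> * (v \<bullet> v)"
    by (simp add: left_diff_distrib)
qed

text \<open>The centres \<open>p + z\<close> of circles through \<open>p\<close> with no site inside are the solutions of the inequalities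
  \<open>2 * (z \<bullet> (q - p)) \<le> (q - p) \<bullet> (q - p)\<close>. Maximising \<open>2 * (z \<bullet> d)\<close> over them is a linear program; its dual asks for a
  conic combination of the vectors \<open>q - p\<close> that equals \<open>d\<close> and has minimal cost, \<open>q - p\<close> being charged its
  squared length. Since \<open>d\<close> enters \<open>P\<close>, the dual has basic solutions, and there are finitely many. The
  basis \<open>a - p\<close>, \<open>b - p\<close> of a cheapest one yields the circle through \<open>p\<close>, \<open>a\<close>, \<open>b\<close>; a site inside it would
  allow a pivot to a cheaper solution.\<close>

lemma entering_vertex_exists:
  assumes fin: "finite P" and inj: "inj_on (wedge d) P" and d: "d \<noteq> 0" and p: "p \<in> P"
    and en: "enters P d p"
  obtains c where "3 \<le> card (nearest P c)" "p \<in> nearest P c" "enters (nearest P c) d p"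
proof -
  define rep where "rep a b \<alpha> \<beta> \<longleftrightarrow> a \<in> P \<and> b \<in> P \<and> \<alpha> > 0 \<and> \<beta> > 0 \<and>
      d = \<alpha> *\<^sub>R (a - p) + \<beta> *\<^sub>R (b - p)" for a b \<alpha> \<beta>
  define cost where "cost a b \<alpha> \<beta> = \<alpha> * ((a - p) \<bullet> (a - p)) + \<beta> * ((b - p) \<bullet> (b - p))" for a b \<alpha> \<beta>
  define costs where "costs = {cost a b \<alpha> \<beta> | a b \<alpha> \<beta>. rep a b \<alpha> \<beta>}"
  have indep: "wedge (a - p) (b - p) \<noteq> 0" if "rep a b \<alpha> \<beta>" for a b \<alpha> \<beta>
    using that entering_pair_independent(1)[OF inj d _ _ p] unfolding rep_def by blast
  \<comment> \<open>By Cramer's rule the coefficients are determined by the pair, so there are finitely many costs.\<close>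
  have "costs \<subseteq> (\<lambda>(a,b). cost a b (wedge d (b - p) / wedge (a - p) (b - p))
      (wedge (a - p) d / wedge (a - p) (b - p))) ` (P \<times> P)"
  proof
    fix k assume "k \<in> costs"
    then obtain a b \<alpha> \<beta> where k: "k = cost a b \<alpha> \<beta>" and r: "rep a b \<alpha> \<beta>" unfolding costs_def by blast
    have ab: "a \<in> P" "b \<in> P" and d': "d = \<alpha> *\<^sub>R (a - p) + \<beta> *\<^sub>R (b - p)"
      using r unfolding rep_def by blast+
    have "wedge d (b - p) = \<alpha> * wedge (a - p) (b - p)" "wedge (a - p) d = \<beta> * wedge (a - p) (b - p)"
      using arg_cong[OF d', of "\<lambda>x. wedge x (b - p)"] arg_cong[OF d', of "wedge (a - p)"]
      by (simp_all only: wedge_simps(1,5,7,9,10))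
    then have "\<alpha> = wedge d (b - p) / wedge (a - p) (b - p)" "\<beta> = wedge (a - p) d / wedge (a - p) (b - p)"
      using indep[OF r] by simp_all
    with k ab show "k \<in> (\<lambda>(a,b). cost a b (wedge d (b - p) / wedge (a - p) (b - p))
      (wedge (a - p) d / wedge (a - p) (b - p))) ` (P \<times> P)" by force
  qed
  then have fc: "finite costs" using fin finite_subset by blast
  moreover have "costs \<noteq> {}" using en unfolding costs_def rep_def enters_def by blast
  ultimately have "Min costs \<in> costs" by simp
  then obtain a b \<alpha> \<beta> where r: "rep a b \<alpha> \<beta>" and min: "cost a b \<alpha> \<beta> = Min costs"
    unfolding costs_def by auto
  have opt: "cost a b \<alpha> \<beta> \<le> cost a' b' \<alpha>' \<beta>'" if "rep a' b' \<alpha>' \<beta>'" for a' b' \<alpha>' \<beta>'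
    unfolding min using fc that by (intro Min_le) (auto simp: costs_def)
  have ab: "a \<in> P" "b \<in> P" and pos: "\<alpha> > 0" "\<beta> > 0" and d': "d = \<alpha> *\<^sub>R (a - p) + \<beta> *\<^sub>R (b - p)"
    using r unfolding rep_def by blast+
  let ?u = "a - p" and ?v = "b - p"
  obtain z where z: "z \<bullet> ?u = (?u \<bullet> ?u) / 2" "z \<bullet> ?v = (?v \<bullet> ?v) / 2"
    using wedge_dual[OF indep[OF r]] .
  \<comment> \<open>A cheaper representation contradicts minimality, unless \<open>s = 0\<close>; but that would make \<open>d\<close> parallel to a line through two sites.\<close>
  have no_gain: False
    if "s \<ge> 0" "t > 0" "d = s *\<^sub>R (e - p) + t *\<^sub>R (q - p)" "e \<in> P" "q \<in> P"
      "s * ((e - p) \<bullet> (e - p)) + t * ((q - p) \<bullet> (q - p)) < cost a b \<alpha> \<beta>" for s t e q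
  proof (cases "s = 0")
    case True
    then have dq: "d = t *\<^sub>R (q - p)" using that(3) by simp
    then have "t * wedge d (q - p) = 0" by (metis wedge_simps(1,9))
    then have "q = p" using inj p that(2,5) by (auto simp: wedge_simps dest: inj_onD)
    with dq d show False by simp
  next
    case False
    then have "rep e q s t" using that unfolding rep_def by simp
    from opt[OF this] that(6) show False unfolding cost_def by simp
  qed
  let ?c = "p + z"
  have "2 * (z \<bullet> (q - p)) \<le> (q - p) \<bullet> (q - p)" if q: "q \<in> P" for q
  proof (rule ccontr)
    assume viol: "\<not> ?thesis"
    obtain \<xi> \<eta> where x: "q - p = \<xi> *\<^sub>R ?u + \<eta> *\<^sub>R ?v" using wedge_basis[OF indep[OF r]] .
    have "2 * (z \<bullet> (q - p)) = \<xi> * (?u \<bullet> ?u) + \<eta> * (?v \<bullet> ?v)"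
      unfolding x inner_right_distrib inner_scaleR_right z by simp
    then have cheap: "(q - p) \<bullet> (q - p) < \<xi> * (?u \<bullet> ?u) + \<eta> * (?v \<bullet> ?v)" using viol by simp
    have "\<xi> > 0 \<or> \<eta> > 0"
    proof (rule ccontr)
      assume "\<not> ?thesis"
      then have "\<xi> * (?u \<bullet> ?u) \<le> 0" "\<eta> * (?v \<bullet> ?v) \<le> 0" by (auto intro: mult_nonpos_nonneg)
      then show False using cheap inner_ge_zero[of "q - p"] by linarith
    qed
    then consider "\<xi> > 0" "\<alpha> * \<eta> \<le> \<beta> * \<xi>" | "\<eta> > 0" "\<beta> * \<xi> \<le> \<alpha> * \<eta>"
      using pos by (smt (verit) mult_pos_pos mult_nonneg_nonpos zero_less_mult_pos)
    then show False
    proof cases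
      case 1
      obtain s t where "s \<ge> 0" "t > 0" "d = s *\<^sub>R ?v + t *\<^sub>R (q - p)"
        "s * (?v \<bullet> ?v) + t * ((q - p) \<bullet> (q - p)) < \<alpha> * (?u \<bullet> ?u) + \<beta> * (?v \<bullet> ?v)"
        using pivot_decreases_cost[OF d' pos x 1 cheap] .
      then show False using no_gain[of s t b q] ab q unfolding cost_def by blast
    next
      case 2
      obtain s t where "s \<ge> 0" "t > 0" "d = s *\<^sub>R ?u + t *\<^sub>R (q - p)"
        "s * (?u \<bullet> ?u) + t * ((q - p) \<bullet> (q - p)) < \<beta> * (?v \<bullet> ?v) + \<alpha> * (?u \<bullet> ?u)"
        using pivot_decreases_cost[of d \<beta> ?v \<alpha> ?u "q - p" \<eta> \<xi>] d' pos x 2 cheap by (auto simp: add.commute)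
      then show False using no_gain[of s t a q] ab q unfolding cost_def by (simp add: add.commute)
    qed
  qed
  then have pn: "p \<in> nearest P ?c" using nearest_iff_inner[OF p, of ?c] by simp
  have abn: "a \<in> nearest P ?c" "b \<in> nearest P ?c"
    using nearest_if_inner_eq[OF pn, of a] nearest_if_inner_eq[OF pn, of b] ab z by simp_all
  have "a \<noteq> p" "b \<noteq> p" "a \<noteq> b" using indep[OF r] by (auto simp: wedge_simps(1-3))
  then have "card {p, a, b} = 3" by simp
  moreover have "card {p, a, b} \<le> card (nearest P ?c)"
    using pn abn fin finite_subset[OF nearest_subset] by (intro card_mono) auto
  ultimately have "3 \<le> card (nearest P ?c)" by simp
  moreover have "enters (nearest P ?c) d p" unfolding enters_def using abn pos d' by blast
  ultimately show ?thesis using that pn by blast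
qed

text \<open>Uniqueness of the optimum of that linear program: both centres are optimal, so their difference is
  orthogonal to \<open>d\<close>, and by complementary slackness to both edges at \<open>p\<close> of an entered triangle.\<close>

lemma entering_vertex_unique:
  assumes inj: "inj_on (wedge d) P" and d: "d \<noteq> 0"
    and c: "p \<in> nearest P c" "enters (nearest P c) d p"
    and c': "p \<in> nearest P c'" "enters (nearest P c') d p"
  shows "c = c'"
proof -
  have *: "0 \<le> (c - c') \<bullet> (x - p)" if "p \<in> nearest P c" "p \<in> nearest P c'" "x \<in> nearest P c" for c c' x
  proof -
    have "2 * ((c - p) \<bullet> (x - p)) = (x - p) \<bullet> (x - p)"
      using inner_from_sphere_point nearest_subset_sphere[OF that(1)] that by blast
    moreover have "2 * ((c' - p) \<bullet> (x - p)) \<le> (x - p) \<bullet> (x - p)"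
      using nearest_iff_inner[of p P c'] that nearest_subset by blast
    ultimately show ?thesis by (simp add: inner_diff_left)
  qed
  have inj': "inj_on (wedge d) (nearest P e)" for e using inj inj_on_subset[OF _ nearest_subset] by blast
  \<comment> \<open>By symmetry, one of the two centres is not ahead of the other in the direction \<open>d\<close>.\<close>
  consider "(c - c') \<bullet> d \<le> 0" | "(c' - c) \<bullet> d \<le> 0" by (metis inner_minus_left minus_diff_eq neg_le_0_iff_le linear)
  then have "c - c' = 0 \<or> c' - c = 0"
  proof cases
    case 1 then show ?thesis using orthogonal_to_entering_pair[OF inj' d c] * c(1) c'(1) by blast
  next
    case 2 then show ?thesis using orthogonal_to_entering_pair[OF inj' d c'] * c(1) c'(1) by blast
  qed
  then show ?thesis by auto
qed

text \<open>A ray that starts at a site and enters the hull of \<open>P\<close> enters exactly one Delaunay polygon, which has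
  that site as a vertex.\<close>

lemma card_entered_by_vertices:
  assumes fin: "finite P" and inj: "inj_on (wedge d) P" and d: "d \<noteq> 0"
  shows "card {p \<in> P. enters P d p} =
    (\<Sum>c\<in>voronoi_iteration P. card {p \<in> nearest P c. enters (nearest P c) d p})"
proof -
  let ?A = "\<lambda>c. {p \<in> nearest P c. enters (nearest P c) d p}"
  have "{p \<in> P. enters P d p} = (\<Union>c\<in>voronoi_iteration P. ?A c)"
  proof (intro set_eqI iffI)
    fix p assume "p \<in> {p \<in> P. enters P d p}"
    then obtain c where "3 \<le> card (nearest P c)" "p \<in> nearest P c" "enters (nearest P c) d p"
      using entering_vertex_exists[OF fin inj d, of p] by blast
    then show "p \<in> (\<Union>c\<in>voronoi_iteration P. ?A c)" unfolding voronoi_iteration_eq[OF fin] by blast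
  next
    fix p assume "p \<in> (\<Union>c\<in>voronoi_iteration P. ?A c)"
    then show "p \<in> {p \<in> P. enters P d p}" using enters_mono[OF _ nearest_subset] nearest_subset by blast
  qed
  moreover have "card (\<Union>c\<in>voronoi_iteration P. ?A c) = (\<Sum>c\<in>voronoi_iteration P. card (?A c))"
  proof (rule card_UN_disjoint)
    show "finite (voronoi_iteration P)" by (rule finite_voronoi_iteration[OF fin])
    show "\<forall>c\<in>voronoi_iteration P. finite (?A c)"
      using fin finite_subset[OF nearest_subset] by simp
    show "\<forall>c\<in>voronoi_iteration P. \<forall>c'\<in>voronoi_iteration P. c \<noteq> c' \<longrightarrow> ?A c \<inter> ?A c' = {}"
      using entering_vertex_unique[OF inj d] by blast
  qed
  ultimately show ?thesis by simp
qed

section \<open>Counting Voronoi vertices\<close>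

text \<open>This is Euler's formula for the Delaunay tessellation. The rays with directions \<open>d\<close> and \<open>- d\<close> from the
  sites that enter the hull are counted in two ways: over all of \<open>P\<close> there are \<open>card P + card (Int_pts P) - 2\<close>
  of them, and a Delaunay polygon with \<open>k\<close> vertices is entered by \<open>k - 2\<close> of them, that is by
  \<open>1 + (k - 3)\<close>. Summed over the polygons, the \<open>1\<close> counts Voronoi vertices and \<open>k - 3\<close> gives \<open>I_c P\<close>.\<close>

theorem card_voronoi_iteration:
  assumes fin: "finite P" and nc: "\<not> collinear P"
  shows "int (card (voronoi_iteration P)) = int (card P) + int (card (Int_pts P)) - 2 - I_c P"
proof -
  let ?V = "voronoi_iteration P"
  obtain d where d: "d \<noteq> 0" "inj_on (wedge d) P" using exists_generic_direction[OF fin] .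
  have local: "int (card {p \<in> nearest P c. enters (nearest P c) d p})
      + int (card {p \<in> nearest P c. enters (nearest P c) (- d) p}) = int (card (nearest P c)) - 2"
    if c: "c \<in> ?V" for c
  proof -
    have card: "3 \<le> card (nearest P c)" using c unfolding voronoi_iteration_eq[OF fin] by simp
    then obtain p where p: "p \<in> nearest P c" by fastforce
    show ?thesis
      using card_entered_sum_on_sphere[OF finite_subset[OF nearest_subset fin] nearest_subset_sphere[OF p] card
          inj_on_subset[OF d(2) nearest_subset] d(1)] by linarith
  qed
  have "int (card P) + int (card (Int_pts P)) - 2 =
      int (card {p \<in> P. enters P d p}) + int (card {p \<in> P. enters P (- d) p})"
    using card_entered_sum[OF fin nc d(2,1)] by linarith
  also have "\<dots> = (\<Sum>c\<in>?V. int (card (nearest P c)) - 2)"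
    using card_entered_by_vertices[OF fin d(2,1)] card_entered_by_vertices[OF fin, of "- d"] d local
    by (simp add: inj_on_wedge_uminus flip: sum.distrib)
  also have "\<dots> = (\<Sum>c\<in>?V. int (card (nearest P c)) - 3) + int (card ?V)"
    by (simp add: sum_subtractf)
  also have "(\<Sum>c\<in>?V. int (card (nearest P c)) - 3) = I_c P"
  proof -
    obtain C where C: "bij_betw C ?V (empty_circles P)" "\<forall>c\<in>?V. C c \<inter> P = nearest P c"
      using bij_empty_circles[OF fin] .
    have "I_c P = (\<Sum>c\<in>?V. int (card (C c \<inter> P)) - 3)"
      unfolding I_c_def by (rule sum.reindex_bij_betw[OF C(1), symmetric])
    then show ?thesis using C(2) by simp
  qed
  finally show ?thesis by simp
qed

lemma I_c_nonneg: "0 \<le> I_c P"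
  unfolding I_c_def empty_circles_def by (intro sum_nonneg) auto

text \<open>The hull is spanned by its extreme points, which are boundary sites; two of them span only a segment.\<close>

lemma card_Bd_ge_3:
  assumes fin: "finite P" and nc: "\<not> collinear P"
  shows "3 \<le> card (Bd P)"
proof (rule ccontr)
  assume "\<not> 3 \<le> card (Bd P)"
  have "finite (Bd P)" using fin by (simp add: Bd_def)
  have "{x. x extreme_point_of (convex hull P)} \<subseteq> P - interior (convex hull P)"
    using extreme_points_of_convex_hull extreme_point_not_in_interior by blast
  also have "\<dots> = Bd P" using Int_pts_eq[of P] unfolding Int_pts_def Bd_def by blast
  finally have "convex hull P \<subseteq> convex hull (Bd P)"
    using Krein_Milman_polytope[OF fin] hull_mono by metis
  moreover have "collinear (Bd P)"
    using \<open>finite (Bd P)\<close> \<open>\<not> 3 \<le> card (Bd P)\<close> by (intro collinear_small) auto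
  ultimately have "collinear P"
    using aff_dim_subset[of "convex hull P" "convex hull (Bd P)"]
    by (simp add: collinear_aff_dim aff_dim_convex_hull)
  with nc show False by blast
qed

lemma card_Int_pts_le:
  assumes "finite P" "\<not> collinear P"
  shows "card (Int_pts P) + 3 \<le> card P"
proof -
  have "Bd P \<subseteq> P" by (simp add: Bd_def)
  then have "card P = card (Bd P) + card (Int_pts P)"
    unfolding Int_pts_def using assms(1)
    by (metis card_Diff_subset card_mono finite_subset le_add_diff_inverse)
  then show ?thesis using card_Bd_ge_3[OF assms] by simp
qed

text \<open>At most \<open>card P - 3\<close> sites are interior. The subtraction truncates, but two or fewer sites are collinear
  and have no Voronoi vertex. The bound maps \<open>5\<close> to \<open>5\<close>, and \<open>4\<close>, \<open>3\<close>, \<open>2\<close> to \<open>3\<close>, \<open>1\<close>, \<open>0\<close>.\<close>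

lemma card_voronoi_iteration_le:
  assumes "finite P"
  shows "card (voronoi_iteration P) \<le> 2 * card P - 5"
proof (cases "collinear P")
  case True
  then show ?thesis using voronoi_iteration_collinear[OF assms] by simp
next
  case False
  then show ?thesis
    using card_voronoi_iteration[OF assms False] card_Int_pts_le[OF assms False] I_c_nonneg[of P] by linarith
qed

lemma funpow_voronoi_eventually_empty:
  assumes "finite P" "card P < 5"
  shows "\<exists>n\<ge>1. (voronoi_iteration ^^ n) P = {}"
proof -
  have step: "card (voronoi_iteration Q) \<le> 2 * card Q - 5" "finite (voronoi_iteration Q)" if "finite Q" for Q
    using card_voronoi_iteration_le finite_voronoi_iteration that by blast+
  let ?Q = "\<lambda>n. (voronoi_iteration ^^ n) P"
  have fin: "finite (?Q n)" for n by (induction n) (simp_all add: assms(1) step(2))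
  have "card (?Q 1) \<le> 3" using step(1)[OF assms(1)] assms(2) by simp
  then have "card (?Q 2) \<le> 1" using step(1)[OF fin[of 1]] by (simp add: numeral_2_eq_2)
  then have "card (?Q 3) = 0" using step(1)[OF fin[of 2]] by (simp add: numeral_3_eq_3 numeral_2_eq_2)
  then have "?Q 3 = {}" using fin by simp
  then show ?thesis by (intro exI[of _ 3]) simp
qed

theorem corollary1:
  fixes P :: "(real^2) set"
  assumes "finite P"
  shows "(card P < 5 \<longrightarrow> (\<exists>n\<ge>1. (voronoi_iteration ^^ n) P = {})) \<and>
    (card P = 5 \<longrightarrow> (\<exists>n\<ge>1. (voronoi_iteration ^^ n) P = {}) \<or>
                    (\<forall>n\<ge>1. card ((voronoi_iteration ^^ n) P) = 5)) \<and>
    (card (voronoi_iteration P) > card P \<longrightarrow> card P > 5) \<and>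
    (card (Int_pts P) = 2 \<and> I_c P = 0 \<longrightarrow> card (voronoi_iteration P) = card P)"
proof (intro conjI impI)
  assume "card P < 5"
  then show "\<exists>n\<ge>1. (voronoi_iteration ^^ n) P = {}"
    using funpow_voronoi_eventually_empty[OF assms] by blast
next
  assume P5: "card P = 5"
  let ?Q = "\<lambda>n. (voronoi_iteration ^^ n) P"
  have fin: "finite (?Q n)" for n by (induction n) (simp_all add: assms finite_voronoi_iteration)
  show "(\<exists>n\<ge>1. ?Q n = {}) \<or> (\<forall>n\<ge>1. card (?Q n) = 5)"
  proof (cases "\<exists>n. card (?Q n) < 5")
    case True
    then obtain n where "card (?Q n) < 5" by blast
    then obtain m where "m \<ge> 1" "(voronoi_iteration ^^ m) (?Q n) = {}"
      using funpow_voronoi_eventually_empty[OF fin] by blast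
    then have "?Q (m + n) = {}" by (simp add: funpow_add)
    then show ?thesis using \<open>m \<ge> 1\<close> by (intro disjI1 exI[of _ "m + n"]) simp
  next
    case False
    have "card (?Q n) = 5" for n
    proof (induction n)
      case 0 show ?case using P5 by simp
    next
      case (Suc n)
      have "card (?Q (Suc n)) \<le> 5" using card_voronoi_iteration_le[OF fin[of n]] Suc by simp
      moreover have "\<not> card (?Q (Suc n)) < 5" using False by blast
      ultimately show ?case by linarith
    qed
    then show ?thesis by blast
  qed
next
  assume "card (voronoi_iteration P) > card P"
  then show "card P > 5" using card_voronoi_iteration_le[OF assms] by linarith
next
  assume a: "card (Int_pts P) = 2 \<and> I_c P = 0"
  have "\<not> collinear P"
  proof
    assume "collinear P"
    then have "interior (convex hull P) = {}"
      using aff_dim_nonempty_interior[of "convex hull P"]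
      by (force simp: aff_dim_convex_hull collinear_aff_dim)
    with a show False by (simp add: Int_pts_eq)
  qed
  then show "card (voronoi_iteration P) = card P" using card_voronoi_iteration[OF assms] a by simp
qed

end
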